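(* Let $w_1,w_2,\ldots,w_k\in S_n$ be distinct permutations such that $l(w_1)=l(w_2)=\cdots=l(w_k)=l$. Then $$|G(w_1)|+|G(w_2)|+\cdots+|G(w_k)|<4^{\,l+n},$$ where $|G(w)|$ denotes the number of commutation classes of reduced decompositions of $w$ (the number of vertices of the graph $G(w)$).
   Context: For $w\in S_n$, $l(w)$ is the number of inversions, i.e. the number of pairs $i<j$ with $w(i)>w(j)$. A reduced decomposition of $w$ is a sequence $(i_1,\ldots,i_{l(w)})$ with entries in $\{1,\ldots,n-1\}$ such that $w=s_{i_1}s_{i_2}\cdots s_{i_{l(w)}}$, where $s_i$ is the adjacent transposition swapping the entries in positions $i$ and $i+1$. Two reduced decompositions of $w$ are in the same commutation class if one can be obtained from the other by a sequence of moves replacing two consecutive entries $i,j$ with $|i-j|\ge 2$ by $j,i$. $G(w)$ is the graph whose vertices are the commutation classes of reduced decompositions of $w$, two vertices being joined by an edge if some reduced decomposition in one class is turned into some reduced decomposition in the other class by replacing three consecutive entries $i,i+1,i$ by $i+1,i,i+1$ or vice versa. *)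

theory Defs
  imports "HOL-Combinatorics.Permutations"
begin

text \<open>Permutations of \<open>{1..n}\<close> are functions \<open>w\<close> with \<open>w permutes {1..n}\<close>, and products are
  compositions of functions. With this convention \<open>w \<circ> s i\<close> is \<open>w\<close> with the entries in
  positions \<open>i\<close> and \<open>i + 1\<close> of its one-line notation swapped.\<close>

definition num_inversions :: "nat \<Rightarrow> (nat \<Rightarrow> nat) \<Rightarrow> nat" where
  "num_inversions n w =
    card {(i, j). i \<in> {1..n} \<and> j \<in> {1..n} \<and> i < j \<and> w i > w j}"

definition adjacent_transposition :: "nat \<Rightarrow> nat \<Rightarrow> nat" where
  "adjacent_transposition i = transpose i (i + 1)"

definition word_product :: "nat list \<Rightarrow> nat \<Rightarrow> nat" where
  "word_product is = foldr (\<circ>) (map adjacent_transposition is) id"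

definition reduced_decompositions :: "nat \<Rightarrow> (nat \<Rightarrow> nat) \<Rightarrow> nat list set" where
  "reduced_decompositions n w =
    {is. length is = num_inversions n w \<and> set is \<subseteq> {1..n - 1} \<and> word_product is = w}"

definition commutation_move :: "nat list \<Rightarrow> nat list \<Rightarrow> bool" where
  "commutation_move u v \<longleftrightarrow>
    (\<exists>xs ys i j. \<bar>int i - int j\<bar> \<ge> 2 \<and> u = xs @ [i, j] @ ys \<and> v = xs @ [j, i] @ ys)"

definition braid_move :: "nat list \<Rightarrow> nat list \<Rightarrow> bool" where
  "braid_move u v \<longleftrightarrow>
    (\<exists>xs ys i. (u = xs @ [i, i + 1, i] @ ys \<and> v = xs @ [i + 1, i, i + 1] @ ys) \<or>
               (u = xs @ [i + 1, i, i + 1] @ ys \<and> v = xs @ [i, i + 1, i] @ ys))"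

definition commutation_rel :: "nat \<Rightarrow> (nat \<Rightarrow> nat) \<Rightarrow> (nat list \<times> nat list) set" where
  "commutation_rel n w =
    {(u, v). u \<in> reduced_decompositions n w \<and> v \<in> reduced_decompositions n w \<and>
             commutation_move\<^sup>*\<^sup>* u v}"

definition commutation_classes :: "nat \<Rightarrow> (nat \<Rightarrow> nat) \<Rightarrow> nat list set set" where
  "commutation_classes n w = reduced_decompositions n w // commutation_rel n w"

text \<open>The graph \<open>G(w)\<close> as a pair of its vertex set and its set of (undirected) edges. A braid
  move changes the multiset of entries, so it always leads to a different commutation class.\<close>

definition G :: "nat \<Rightarrow> (nat \<Rightarrow> nat) \<Rightarrow> nat list set set \<times> nat list set set set" where
  "G n w =
    (commutation_classes n w,
     {{C, D} | C D. C \<in> commutation_classes n w \<and> D \<in> commutation_classes n w \<and>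
                    (\<exists>u \<in> C. \<exists>v \<in> D. braid_move u v)})"

definition num_vertices :: "'v set \<times> 'v set set \<Rightarrow> nat" where
  "num_vertices H = card (fst H)"

end

theory Submission
  imports Defs
begin

text \<open>Sorting adjacent commuting entries increasingly, every commutation class contains a word
  whose entries never drop by more than one from one position to the next. Such a word determines
  its permutation, so the sum is at most the number of words of this kind of length \<open>l\<close> over
  \<open>{1..n - 1}\<close>. By induction on the length, at most \<open>4 ^ l * 2 ^ (n - i)\<close> of them can follow a
  letter \<open>i\<close>: the next letter \<open>j\<close> is at least \<open>i - 1\<close>, and summing the geometric series over \<open>j\<close>
  costs a factor 4.\<close>

section \<open>Counting slow words\<close>

definition slow :: "nat list \<Rightarrow> bool" where
  "slow = successively (\<lambda>a b. a \<le> b + 1)"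

lemma slow_Nil [simp]: "slow []"
  and slow_single [simp]: "slow [x]"
  and slow_Cons_Cons [simp]: "slow (x # y # zs) \<longleftrightarrow> x \<le> y + 1 \<and> slow (y # zs)"
  by (simp_all add: slow_def)

text \<open>The letter \<open>i\<close> is only the context to the left and does not count towards
  the length \<open>l\<close>. Letter 0 is allowed, so the next letter ranges over
  \<open>{i - 1..m}\<close> for every \<open>i\<close>, including \<open>i = 0\<close>.\<close>

definition slow_words_after :: "nat \<Rightarrow> nat \<Rightarrow> nat \<Rightarrow> nat list set" where
  "slow_words_after m l i = {u. length u = l \<and> set u \<subseteq> {..m} \<and> slow (i # u)}"

lemma finite_slow_words_after: "finite (slow_words_after m l i)"
  by (rule finite_subset [OF _ finite_lists_length_eq [of "{..m}" l]])
    (auto simp: slow_words_after_def)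

lemma slow_words_after_Suc:
  "slow_words_after m (Suc l) i \<subseteq> (\<Union>j\<in>{i - 1..m}. (#) j ` slow_words_after m l j)"
proof
  fix u assume "u \<in> slow_words_after m (Suc l) i"
  then obtain j v where "u = j # v" "length v = l" "set (j # v) \<subseteq> {..m}" "slow (i # j # v)"
    by (cases u) (auto simp: slow_words_after_def)
  then show "u \<in> (\<Union>j\<in>{i - 1..m}. (#) j ` slow_words_after m l j)"
    by (auto simp: slow_words_after_def)
qed

text \<open>A finite geometric series, with the 2 kept on the left to avoid subtraction on
  \<open>nat\<close>. The empty range \<open>a = m + 1\<close> is included because the induction
  starts from it.\<close>

lemma sum_power_2_diff:
  fixes a m :: nat
  assumes "a \<le> m + 1"
  shows "(\<Sum>j = a..m. 2 ^ (m + 1 - j)) + 2 = (2 ^ (m + 2 - a) :: nat)"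
  using assms
proof (induction m)
  case 0
  then have "a = 0 \<or> a = 1" by auto
  then show ?case by auto
next
  case (Suc m)
  show ?case
  proof (cases "a = m + 2")
    case True
    then show ?thesis by simp
  next
    case False
    with Suc have a: "a \<le> m + 1" by simp
    \<comment> \<open>Raising \<open>m\<close> by one doubles every old term; the new term at
      \<open>j = Suc m\<close> is 2 and, with the 2 already there, makes up the doubled
      constant.\<close>
    have "(\<Sum>j = a..m. 2 ^ (Suc m + 1 - j)) = (\<Sum>j = a..m. 2 * 2 ^ (m + 1 - j) :: nat)"
      by (intro sum.cong) (auto simp: Suc_diff_le)
    then have "(\<Sum>j = a..Suc m. 2 ^ (Suc m + 1 - j)) + 2
        = 2 * ((\<Sum>j = a..m. 2 ^ (m + 1 - j)) + 2 :: nat)"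
      using a by (simp add: sum_distrib_left)
    also have "\<dots> = 2 ^ (Suc m + 2 - a)"
      using Suc.IH [OF a] a by (simp add: Suc_diff_le)
    finally show ?thesis .
  qed
qed

lemma card_slow_words_after:
  assumes "i \<le> m + 1"
  shows "card (slow_words_after m l i) \<le> 4 ^ l * 2 ^ (m + 1 - i)"
  using assms
proof (induction l arbitrary: i)
  case 0
  have "slow_words_after m 0 i = {[]}" by (auto simp: slow_words_after_def)
  then show ?case by simp
next
  case (Suc l)
  have "card (slow_words_after m (Suc l) i)
      \<le> card (\<Union>j\<in>{i - 1..m}. (#) j ` slow_words_after m l j)"
    by (intro card_mono slow_words_after_Suc) (auto simp: finite_slow_words_after)
  also have "\<dots> \<le> (\<Sum>j = i - 1..m. card ((#) j ` slow_words_after m l j))"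
    by (intro card_UN_le) simp
  also have "\<dots> \<le> (\<Sum>j = i - 1..m. 4 ^ l * 2 ^ (m + 1 - j))"
  proof (rule sum_mono)
    fix j assume "j \<in> {i - 1..m}"
    then have "card (slow_words_after m l j) \<le> 4 ^ l * 2 ^ (m + 1 - j)"
      by (intro Suc.IH) auto
    then show "card ((#) j ` slow_words_after m l j) \<le> 4 ^ l * 2 ^ (m + 1 - j)"
      using card_image_le [OF finite_slow_words_after] order_trans by blast
  qed
  also have "\<dots> = 4 ^ l * (\<Sum>j = i - 1..m. 2 ^ (m + 1 - j))"
    by (simp add: sum_distrib_left)
  also have "\<dots> \<le> 4 ^ l * 2 ^ (m + 2 - (i - 1))"
    using sum_power_2_diff [of "i - 1" m] Suc.prems by (intro mult_left_mono) linarith+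
  \<comment> \<open>The exponents agree for \<open>i \<ge> 1\<close>; for \<open>i = 0\<close>
    truncated subtraction makes the left one smaller by 1.\<close>
  also have "\<dots> \<le> 4 ^ l * 2 ^ (m + 1 - i + 2)"
    using Suc.prems by (intro mult_left_mono power_increasing) auto
  also have "\<dots> = 4 ^ Suc l * 2 ^ (m + 1 - i)"
    by (simp add: power_add)
  finally show ?case .
qed

section \<open>Commutation moves on reduced decompositions\<close>

lemma adjacent_transposition_commute:
  assumes "\<bar>int i - int j\<bar> \<ge> 2"
  shows "adjacent_transposition i \<circ> adjacent_transposition j
    = adjacent_transposition j \<circ> adjacent_transposition i"
  using assms by (auto simp: fun_eq_iff adjacent_transposition_def transpose_def)

lemma word_product_append: "word_product (u @ v) = word_product u \<circ> word_product v"
  by (induction u) (auto simp: word_product_def)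

lemma commutation_move_word_product:
  assumes "commutation_move u v"
  shows "word_product v = word_product u"
proof -
  from assms obtain xs ys i j where ij: "\<bar>int i - int j\<bar> \<ge> 2"
    and u: "u = xs @ [i, j] @ ys" and v: "v = xs @ [j, i] @ ys"
    unfolding commutation_move_def by blast
  have "word_product [j, i] = word_product [i, j]"
    using adjacent_transposition_commute [OF ij] by (simp add: word_product_def)
  then show ?thesis
    by (simp only: u v word_product_append)
qed

lemma commutation_move_reduced_decompositions:
  assumes "commutation_move u v" "u \<in> reduced_decompositions n w"
  shows "v \<in> reduced_decompositions n w"
  using assms(2) commutation_move_word_product [OF assms(1)] assms(1)
  by (auto simp: reduced_decompositions_def commutation_move_def)

text \<open>Ensures that a slow word reached from a reduced decomposition is itself one, and so lies
  in the same class.\<close>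

lemma commutation_moves_reduced_decompositions:
  assumes "commutation_move\<^sup>*\<^sup>* u v" "u \<in> reduced_decompositions n w"
  shows "v \<in> reduced_decompositions n w"
  using assms by induction (auto intro: commutation_move_reduced_decompositions)

lemma symp_commutation_move: "symp commutation_move"
proof (rule sympI)
  fix u v assume "commutation_move u v"
  then obtain xs ys i j where "\<bar>int i - int j\<bar> \<ge> 2" "u = xs @ [i, j] @ ys" "v = xs @ [j, i] @ ys"
    unfolding commutation_move_def by blast
  then show "commutation_move v u"
    unfolding commutation_move_def by (metis abs_minus_commute)
qed

lemma equiv_commutation_rel: "equiv (reduced_decompositions n w) (commutation_rel n w)"
proof (rule equivI)
  show "sym (commutation_rel n w)"
    using sympD [OF symp_rtranclp [OF symp_commutation_move]]
    by (auto simp: commutation_rel_def intro!: symI)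
qed (auto simp: commutation_rel_def refl_on_def trans_def)

section \<open>Slow representatives by insertion sort\<close>

lemma commutation_move_Cons: "commutation_move u v \<Longrightarrow> commutation_move (x # u) (x # v)"
  unfolding commutation_move_def by (metis append_Cons)

lemma commutation_moves_Cons: "commutation_move\<^sup>*\<^sup>* u v \<Longrightarrow> commutation_move\<^sup>*\<^sup>* (x # u) (x # v)"
  by (induction rule: rtranclp_induct) (auto intro: rtranclp.rtrancl_into_rtrancl commutation_move_Cons)

text \<open>The letter \<open>a\<close> travels right past each \<open>b\<close> with
  \<open>b + 1 < a\<close>, which commutes with it, and stops at the first \<open>b\<close> with
  \<open>a \<le> b + 1\<close>. The condition on \<open>hd v\<close> carries the induction: a passed
  letter \<open>b\<close> is then followed by \<open>a\<close>, which is larger, or by the letter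
  that already followed it in a slow word.\<close>

lemma slow_insert:
  assumes "slow u"
  shows "\<exists>v. commutation_move\<^sup>*\<^sup>* (a # u) v \<and> slow v \<and> v \<noteq> [] \<and> hd v \<in> {a, hd u}"
  using assms
proof (induction u)
  case Nil
  then show ?case by (intro exI [of _ "[a]"]) auto
next
  case (Cons b u)
  show ?case
  proof (cases "a \<le> b + 1")
    case True
    with Cons.prems show ?thesis by (intro exI [of _ "a # b # u"]) auto
  next
    case False
    have "slow u" using Cons.prems by (cases u) auto
    show ?thesis
    \<comment> \<open>For empty \<open>u\<close> the value \<open>hd u\<close> is unspecified, so
      the condition on \<open>hd v\<close> would say nothing about the letter after
      \<open>b\<close>.\<close>
    proof (cases u)
      case Nil
      have "commutation_move [a, b] [b, a]"
        using False unfolding commutation_move_def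
        by (intro exI [of _ "[]"] exI [of _ a] exI [of _ b]) auto
      with False Nil show ?thesis by (intro exI [of _ "[b, a]"]) auto
    next
      case (Cons c u')
      from Cons.IH [OF \<open>slow u\<close>] obtain v where v: "commutation_move\<^sup>*\<^sup>* (a # u) v" "slow v"
        "v \<noteq> []" "hd v \<in> {a, hd u}" by blast
      have "commutation_move (a # b # u) (b # a # u)"
        using False unfolding commutation_move_def
        by (intro exI [of _ "[]"] exI [of _ u] exI [of _ a] exI [of _ b]) auto
      with commutation_moves_Cons [OF v(1), of b]
      have "commutation_move\<^sup>*\<^sup>* (a # b # u) (b # v)"
        by (rule converse_rtranclp_into_rtranclp [rotated])
      moreover have "slow (b # v)"
        using v False Cons.prems Cons by (cases v) auto
      ultimately show ?thesis by (intro exI [of _ "b # v"]) auto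
    qed
  qed
qed

lemma slow_representative: "\<exists>v. commutation_move\<^sup>*\<^sup>* u v \<and> slow v"
proof (induction u)
  case Nil
  show ?case by (intro exI [of _ "[]"]) auto
next
  case (Cons a u)
  then obtain v where "commutation_move\<^sup>*\<^sup>* u v" "slow v" by blast
  then show ?case
    using slow_insert [of v a] commutation_moves_Cons [of u v a] by (meson rtranclp_trans)
qed

lemma finite_reduced_decompositions: "finite (reduced_decompositions n w)"
  by (rule finite_subset [OF _ finite_lists_length_eq [of "{1..n - 1}" "num_inversions n w"]])
    (auto simp: reduced_decompositions_def)

text \<open>Mapping a slow reduced decomposition to its class is onto, since every class has a slow
  representative.\<close>

lemma card_commutation_classes_le:
  "card (commutation_classes n w) \<le> card {u \<in> reduced_decompositions n w. slow u}"
proof -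
  have "commutation_classes n w
      \<subseteq> (\<lambda>v. commutation_rel n w `` {v}) ` {u \<in> reduced_decompositions n w. slow u}"
  proof
    fix C assume "C \<in> commutation_classes n w"
    then obtain u where u: "u \<in> reduced_decompositions n w" and C: "C = commutation_rel n w `` {u}"
      unfolding commutation_classes_def by (rule quotientE)
    obtain v where v: "commutation_move\<^sup>*\<^sup>* u v" "slow v"
      using slow_representative by blast
    with u have v': "v \<in> reduced_decompositions n w"
      by (blast intro: commutation_moves_reduced_decompositions)
    with u v have "(u, v) \<in> commutation_rel n w"
      by (simp add: commutation_rel_def)
    then have "C = commutation_rel n w `` {v}"
      unfolding C by (rule equiv_class_eq [OF equiv_commutation_rel])
    with v v' show "C \<in> (\<lambda>v. commutation_rel n w `` {v}) ` {u \<in> reduced_decompositions n w. slow u}"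
      by blast
  qed
  then show ?thesis
    by (rule surj_card_le [rotated]) (simp add: finite_reduced_decompositions)
qed

theorem theorem3p2:
  fixes n k l :: nat and w :: "nat \<Rightarrow> nat \<Rightarrow> nat"
  assumes "n \<ge> 1"
    and "\<And>i. i \<in> {1..k} \<Longrightarrow> w i permutes {1..n}"
    and "inj_on w {1..k}"
    and "\<And>i. i \<in> {1..k} \<Longrightarrow> num_inversions n (w i) = l"
  shows "(\<Sum>i = 1..k. num_vertices (G n (w i))) < 4 ^ (l + n)"
proof -
  let ?S = "\<lambda>i. {u \<in> reduced_decompositions n (w i). slow u}"
  have "(\<Sum>i = 1..k. num_vertices (G n (w i))) \<le> (\<Sum>i = 1..k. card (?S i))"
    by (intro sum_mono) (simp add: num_vertices_def G_def card_commutation_classes_le)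
  also have "\<dots> = card (\<Union>i\<in>{1..k}. ?S i)"
  proof (rule card_UN_disjoint [symmetric])
    \<comment> \<open>A word has only one product, so a common element would force
      \<open>w i = w j\<close>.\<close>
    show "\<forall>i\<in>{1..k}. \<forall>j\<in>{1..k}. i \<noteq> j \<longrightarrow> ?S i \<inter> ?S j = {}"
    proof (intro ballI impI)
      fix i j assume "i \<in> {1..k}" "j \<in> {1..k}" "i \<noteq> j"
      then have "w i \<noteq> w j" using inj_onD [OF assms(3)] by blast
      then show "?S i \<inter> ?S j = {}" by (auto simp: reduced_decompositions_def)
    qed
  qed (simp_all add: finite_reduced_decompositions)
  \<comment> \<open>A preceding letter 0 imposes no condition, because \<open>0 \<le> b + 1\<close>
    for every \<open>b\<close>.\<close>
  also have "\<dots> \<le> card (slow_words_after (n - 1) l 0)"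
  proof (rule card_mono [OF finite_slow_words_after], rule UN_least, rule subsetI)
    fix i u assume i: "i \<in> {1..k}" and u: "u \<in> ?S i"
    then show "u \<in> slow_words_after (n - 1) l 0"
      using assms(4) [OF i] by (cases u) (auto simp: slow_words_after_def reduced_decompositions_def)
  qed
  also have "\<dots> \<le> 4 ^ l * 2 ^ n"
    using card_slow_words_after [of 0 "n - 1" l] assms(1) by simp
  \<comment> \<open>Strictness comes from \<open>2 ^ n < 4 ^ n\<close>, which holds as
    \<open>n \<ge> 1\<close>.\<close>
  also have "\<dots> < 4 ^ l * 4 ^ n"
    using assms(1) by (intro mult_strict_left_mono power_strict_mono) auto
  finally show ?thesis
    by (simp add: power_add)
qed

end
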